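(* Let $\Theta$ be an arbitrary (possibly infinite) relational language and let $<$ be a binary relation symbol with ${<} \notin \Theta$. Let $\mathbf{Rel}(\Theta, <)$ be the category whose objects are all finite linearly ordered $\Theta$-structures and whose morphisms are embeddings. Then $\mathbf{Rel}(\Theta, <)$ has the Ramsey property; that is, for every integer $k \ge 2$ and all objects $\mathcal{A}, \mathcal{B}$ of $\mathbf{Rel}(\Theta, <)$ such that there is an embedding $\mathcal{A} \hookrightarrow \mathcal{B}$, there exists an object $\mathcal{C}$ of $\mathbf{Rel}(\Theta, <)$ such that $\mathcal{C} \longrightarrow (\mathcal{B})^{\mathcal{A}}_k$.
   Context: A relational language $\Theta$ is a set of relation symbols, each $R \in \Theta$ having a positive integer arity $\mathrm{ar}(R)$. A $\Theta$-structure is a set $A$ together with an interpretation $R^{\mathcal{A}} \subseteq A^{\mathrm{ar}(R)}$ for each $R \in \Theta$; it is finite if $A$ is finite. A linearly ordered $\Theta$-structure is a $(\Theta \cup \{<\})$-structure $\mathcal{A} = (A, \Theta^{\mathcal{A}}, <^{\mathcal{A}})$ in which $<^{\mathcal{A}}$ is a (strict) linear order on $A$. An embedding $f : \mathcal{A} \hookrightarrow \mathcal{B}$ between such structures is an injective map $f : A \to B$ which preserves and reflects all relations, including $<$; i.e. for every $R \in \Theta \cup \{<\}$ of arity $r$ and all $a_1, \dots, a_r \in A$: $(a_1, \dots, a_r) \in R^{\mathcal{A}}$ if and only if $(f(a_1), \dots, f(a_r)) \in R^{\mathcal{B}}$. Arrow notation: for objects $A, B, C$ of a category $\mathbf{C}$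 and an integer $k \ge 2$, $C \longrightarrow (B)^A_k$ means that for every map (coloring) $\chi : \hom_{\mathbf{C}}(A, C) \to \{1, \dots, k\}$ there is a morphism $w \in \hom_{\mathbf{C}}(B, C)$ such that $\chi$ is constant on $w \cdot \hom_{\mathbf{C}}(A, B) = \{w \cdot f : f \in \hom_{\mathbf{C}}(A, B)\}$. A category $\mathbf{C}$ has the Ramsey property if for every integer $k \ge 2$ and all objects $A, B$ of $\mathbf{C}$ with $\hom_{\mathbf{C}}(A, B) \ne \varnothing$ there is an object $C$ of $\mathbf{C}$ with $C \longrightarrow (B)^A_k$. *)

theory Defs
  imports Main "HOL-Library.FuncSet"
begin

record ('o, 'm) category =
  Obj :: "'o set"
  Hom :: "'o \<Rightarrow> 'o \<Rightarrow> 'm set"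
  Ident :: "'o \<Rightarrow> 'm"
  Comp :: "'o \<Rightarrow> 'o \<Rightarrow> 'o \<Rightarrow> 'm \<Rightarrow> 'm \<Rightarrow> 'm"
    \<comment> \<open>for \<open>f \<in> Hom A B\<close> and \<open>g \<in> Hom B C\<close>, the composite \<open>g \<cdot> f\<close> is \<open>Comp A B C g f\<close>\<close>

definition is_category :: "('o, 'm) category \<Rightarrow> bool" where
  "is_category \<C> \<longleftrightarrow>
     (\<forall>A\<in>Obj \<C>. Ident \<C> A \<in> Hom \<C> A A) \<and>
     (\<forall>A\<in>Obj \<C>. \<forall>B\<in>Obj \<C>. \<forall>f\<in>Hom \<C> A B.
        Comp \<C> A A B f (Ident \<C> A) = f \<and> Comp \<C> A B B (Ident \<C> B) f = f) \<and>
     (\<forall>A\<in>Obj \<C>. \<forall>B\<in>Obj \<C>. \<forall>C\<in>Obj \<C>. \<forall>f\<in>Hom \<C> A B. \<forall>g\<in>Hom \<C> B C.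
        Comp \<C> A B C g f \<in> Hom \<C> A C) \<and>
     (\<forall>A\<in>Obj \<C>. \<forall>B\<in>Obj \<C>. \<forall>C\<in>Obj \<C>. \<forall>D\<in>Obj \<C>.
      \<forall>f\<in>Hom \<C> A B. \<forall>g\<in>Hom \<C> B C. \<forall>h\<in>Hom \<C> C D.
        Comp \<C> A C D h (Comp \<C> A B C g f) = Comp \<C> A B D (Comp \<C> B C D h g) f)"

text \<open>\<open>arrows \<C> C B A k\<close> is the partition relation $C \longrightarrow (B)^A_k$ in \<open>\<C>\<close>.\<close>

definition arrows :: "('o, 'm) category \<Rightarrow> 'o \<Rightarrow> 'o \<Rightarrow> 'o \<Rightarrow> nat \<Rightarrow> bool" where
  "arrows \<C> C B A k \<longleftrightarrow>
     (\<forall>\<chi>. \<chi> \<in> Hom \<C> A C \<rightarrow> {1..k} \<longrightarrow>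
        (\<exists>w\<in>Hom \<C> B C. \<exists>c. \<forall>f\<in>Hom \<C> A B. \<chi> (Comp \<C> A B C w f) = c))"

definition ramsey_property :: "('o, 'm) category \<Rightarrow> bool" where
  "ramsey_property \<C> \<longleftrightarrow>
     (\<forall>k::nat. k \<ge> 2 \<longrightarrow>
        (\<forall>A\<in>Obj \<C>. \<forall>B\<in>Obj \<C>. Hom \<C> A B \<noteq> {} \<longrightarrow> (\<exists>C\<in>Obj \<C>. arrows \<C> C B A k)))"

text \<open>
  A relational language is a set \<open>L\<close> of symbols together with an arity function \<open>ar\<close>; tuples of
  length \<open>r\<close> are lists of length \<open>r\<close>.
\<close>

record ('r, 'u) rel_structure =
  univ :: "'u set"
  interp :: "'r \<Rightarrow> 'u list set"

text \<open>
  Symbols outside the language are interpreted as \<open>{}\<close>, so that equality of records is equality of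
  structures.  The universe may be empty.
\<close>

definition is_structure :: "'r set \<Rightarrow> ('r \<Rightarrow> nat) \<Rightarrow> ('r, 'u) rel_structure \<Rightarrow> bool" where
  "is_structure L ar A \<longleftrightarrow>
     (\<forall>R\<in>L. interp A R \<subseteq> {xs. length xs = ar R \<and> set xs \<subseteq> univ A}) \<and>
     (\<forall>R. R \<notin> L \<longrightarrow> interp A R = {})"

definition linearly_ordered_structure ::
    "'r set \<Rightarrow> ('r \<Rightarrow> nat) \<Rightarrow> 'r \<Rightarrow> ('r, 'u) rel_structure \<Rightarrow> bool" where
  "linearly_ordered_structure \<Theta> ar lt A \<longleftrightarrow>
     is_structure (insert lt \<Theta>) ar A \<and>
     strict_linear_order_on (univ A) {(x, y). [x, y] \<in> interp A lt}"

text \<open>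
  Embeddings are extensional functions (\<open>undefined\<close> outside the universe of the domain), so that
  they correspond exactly to maps between the universes; a colouring of a hom-set must not see the
  values of a HOL function outside that universe.
\<close>

definition embeddings ::
    "'r set \<Rightarrow> ('r \<Rightarrow> nat) \<Rightarrow> ('r, 'u) rel_structure \<Rightarrow> ('r, 'v) rel_structure \<Rightarrow> ('u \<Rightarrow> 'v) set" where
  "embeddings L ar A B =
     {f \<in> univ A \<rightarrow>\<^sub>E univ B. inj_on f (univ A) \<and>
        (\<forall>R\<in>L. \<forall>xs. length xs = ar R \<and> set xs \<subseteq> univ A \<longrightarrow>
           (xs \<in> interp A R \<longleftrightarrow> map f xs \<in> interp B R))}"

text \<open>
  The category \<open>Rel(\<Theta>, <)\<close>, with \<open>lt\<close> as the symbol \<open><\<close>.  Its objects are the finite linearly ordered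
  structures whose universe is a subset of the type \<open>'u\<close>.  For infinite \<open>'u\<close> every finite structure
  has an isomorphic copy among them.
\<close>

definition Rel ::
    "'r set \<Rightarrow> ('r \<Rightarrow> nat) \<Rightarrow> 'r \<Rightarrow> (('r, 'u) rel_structure, 'u \<Rightarrow> 'u) category" where
  "Rel \<Theta> ar lt =
     \<lparr>Obj = {A. finite (univ A) \<and> linearly_ordered_structure \<Theta> ar lt A},
      Hom = embeddings (insert lt \<Theta>) ar,
      Ident = (\<lambda>A. \<lambda>x\<in>univ A. x),
      Comp = (\<lambda>A B C g f. compose (univ A) g f)\<rparr>"

lemma embeddings_compose:
  assumes f: "f \<in> embeddings L ar A B" and g: "g \<in> embeddings L ar B C"
  shows "compose (univ A) g f \<in> embeddings L ar A C"
proof -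
  have fm: "f \<in> univ A \<rightarrow> univ B" and gm: "g \<in> univ B \<rightarrow> univ C"
    using f g by (auto simp: embeddings_def)
  have inj: "inj_on (compose (univ A) g f) (univ A)"
    using f g fm by (auto simp: embeddings_def inj_on_def compose_eq Pi_iff)
  have "xs \<in> interp A R \<longleftrightarrow> map (compose (univ A) g f) xs \<in> interp C R"
    if "R \<in> L" "length xs = ar R" "set xs \<subseteq> univ A" for R xs
  proof -
    have "map (compose (univ A) g f) xs = map g (map f xs)"
      using that(3) by (auto simp: compose_eq)
    moreover have "set (map f xs) \<subseteq> univ B" using that(3) fm by auto
    ultimately show ?thesis using f g that by (simp add: embeddings_def del: map_map)
  qed
  moreover have "compose (univ A) g f \<in> univ A \<rightarrow>\<^sub>E univ C"
    using fm gm by (auto simp: compose_def)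
  ultimately show ?thesis using inj by (simp add: embeddings_def)
qed

lemma is_category_Rel: "is_category (Rel \<Theta> ar lt :: (('r, 'u) rel_structure, 'u \<Rightarrow> 'u) category)"
proof -
  have id: "(\<lambda>x\<in>univ A. x) \<in> embeddings L ar A A"
    for L :: "'r set" and ar and A :: "('r, 'u) rel_structure"
  proof -
    have "map (\<lambda>x\<in>univ A. x) xs = xs" if "set xs \<subseteq> univ A" for xs
      using that by (auto intro!: map_idI)
    then show ?thesis by (auto simp: embeddings_def inj_on_def)
  qed
  have emb: "f \<in> univ A \<rightarrow> univ B" "f \<in> extensional (univ A)"
    if "f \<in> embeddings L ar A B"
    for L :: "'r set" and ar f and A B :: "('r, 'u) rel_structure"
    using that by (auto simp: embeddings_def PiE_def)
  have "compose (univ A) (compose (univ B) h g) f = compose (univ A) h (compose (univ A) g f)"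
    if "f \<in> embeddings L ar A B"
    for L :: "'r set" and ar and f g h :: "'u \<Rightarrow> 'u" and A B :: "('r, 'u) rel_structure"
    using emb(1)[OF that] by (auto simp: compose_def fun_eq_iff)
  moreover have "compose (univ A) f (\<lambda>x\<in>univ A. x) = f"
    if "f \<in> embeddings L ar A B"
    for L :: "'r set" and ar and f and A B :: "('r, 'u) rel_structure"
    using compose_Id[OF emb[OF that]] .
  ultimately show ?thesis
    unfolding is_category_def Rel_def
    by (auto simp: id embeddings_compose Id_compose emb)
qed

end

theory Submission
  imports Defs "HOL-Library.Ramsey" "HOL-Library.Countable" "HOL-Library.Nat_Bijection"
    "HOL-Library.Infinite_Set"
begin

text \<open>
  Along its linear order, a finite structure is a colouring of the subsets of \<open>{..<n}\<close> by types, and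
  embeddings are the increasing maps that preserve these colours; this removes arities and the size
  of the language from the problem.  The rest is a partite construction.  Take \<open>p\<close> large for Ramsey's
  theorem and start from the disjoint union of copies of \<open>B\<close>, one over each \<open>b\<close>-subset of \<open>{..<p}\<close>.
  Then treat the \<open>a\<close>-subsets \<open>e\<close> of \<open>{..<p}\<close> one after the other, each time enlarging the system such
  that some copy of the previous one has all its copies of \<open>A\<close> over \<open>e\<close> in one colour: apply the
  Hales--Jewett theorem to words whose letters are the copies of \<open>A\<close> over \<open>e\<close>.  No amalgamation is
  needed, because the parts outside \<open>e\<close> are also made of words, with a blank at every constant
  coordinate of a combinatorial line.  In the end the colour of a copy of \<open>A\<close> depends on its
  projection \<open>e\<close> only, and Ramsey's theorem applies.
\<close>

subsection \<open>The Hales--Jewett theorem\<close>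

definition words :: "'a set \<Rightarrow> nat \<Rightarrow> 'a list set" where
  "words A n = {xs. set xs \<subseteq> A \<and> length xs = n}"

text \<open>A combinatorial line is coded by its template: \<open>None\<close> marks the moving
  coordinates, \<open>Some\<close> the constant ones.\<close>

definition instantiate :: "'a option list \<Rightarrow> 'a \<Rightarrow> 'a list" where
  "instantiate \<tau> a = map (case_option a id) \<tau>"

definition lines :: "'a set \<Rightarrow> nat \<Rightarrow> 'a option list set" where
  "lines A n = {\<tau>. set \<tau> \<subseteq> insert None (Some ` A) \<and> None \<in> set \<tau> \<and> length \<tau> = n}"

definition mono_line :: "'a set \<Rightarrow> nat \<Rightarrow> ('a list \<Rightarrow> 'c) \<Rightarrow> bool" where
  "mono_line A n \<chi> \<longleftrightarrow> (\<exists>\<tau>\<in>lines A n. \<exists>c. \<forall>a\<in>A. \<chi> (instantiate \<tau> a) = c)"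

lemma finite_words: "finite A \<Longrightarrow> finite (words A n)"
  unfolding words_def by (rule finite_lists_length_eq)

lemma words_append: "u \<in> words A m \<Longrightarrow> v \<in> words A n \<Longrightarrow> u @ v \<in> words A (m + n)"
  by (auto simp: words_def)

lemma words_mono: "A \<subseteq> B \<Longrightarrow> u \<in> words A n \<Longrightarrow> u \<in> words B n"
  by (auto simp: words_def)

lemma lines_mono: "A \<subseteq> B \<Longrightarrow> u \<in> lines A n \<Longrightarrow> u \<in> lines B n"
  unfolding lines_def by blast

lemma instantiate_words: "\<tau> \<in> lines A n \<Longrightarrow> a \<in> A \<Longrightarrow> instantiate \<tau> a \<in> words A n"
  by (force simp: lines_def words_def instantiate_def)

lemma instantiate_append: "instantiate (\<sigma> @ \<tau>) a = instantiate \<sigma> a @ instantiate \<tau> a"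
  by (simp add: instantiate_def)

lemma instantiate_map_Some [simp]: "instantiate (map Some w) a = w"
  by (simp add: instantiate_def comp_def)

lemma lines_append: "\<sigma> \<in> lines A m \<Longrightarrow> \<tau> \<in> lines A n \<Longrightarrow> \<sigma> @ \<tau> \<in> lines A (m + n)"
  by (auto simp: lines_def)

lemma lines_append_word: "\<sigma> \<in> lines A m \<Longrightarrow> v \<in> words A n \<Longrightarrow> \<sigma> @ map Some v \<in> lines A (m + n)"
  by (auto simp: lines_def words_def)

lemma lines_word_append: "u \<in> words A m \<Longrightarrow> \<tau> \<in> lines A n \<Longrightarrow> map Some u @ \<tau> \<in> lines A (m + n)"
  by (auto simp: lines_def words_def)

text \<open>Lets functions serve as colours, as the focusing argument requires.\<close>

lemma mono_line_finite_colours: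
  assumes nat: "\<And>\<chi> :: 'a list \<Rightarrow> nat. \<chi> \<in> words A n \<rightarrow> {..<card K} \<Longrightarrow> mono_line A n \<chi>"
    and "finite K" and \<chi>: "\<chi> \<in> words A n \<rightarrow> K"
  shows "mono_line A n \<chi>"
proof -
  obtain h where h: "bij_betw h K {..<card K}"
    using ex_bij_betw_finite_nat[OF \<open>finite K\<close>] by (auto simp: atLeast0LessThan)
  then have "h \<circ> \<chi> \<in> words A n \<rightarrow> {..<card K}"
    using \<chi> bij_betwE[OF h] by (auto simp: Pi_iff)
  from nat[OF this] obtain \<tau> c where \<tau>: "\<tau> \<in> lines A n"
    and c: "\<And>a. a \<in> A \<Longrightarrow> h (\<chi> (instantiate \<tau> a)) = c"
    by (auto simp: mono_line_def)
  have "\<chi> (instantiate \<tau> a) = inv_into K h c" if "a \<in> A" for a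
    using bij_betw_inv_into_left[OF h, of "\<chi> (instantiate \<tau> a)"] c[OF that]
      funcset_mem[OF \<chi> instantiate_words[OF \<tau> that]] by simp
  then show ?thesis using \<tau> unfolding mono_line_def by blast
qed

text \<open>A set \<open>C\<close> of colours is focused at \<open>f\<close> if each \<open>c \<in> C\<close> is the colour, away from the letter
  \<open>x\<close>, of a line that passes through \<open>f\<close> at \<open>x\<close>.\<close>

definition focused :: "'a set \<Rightarrow> 'a \<Rightarrow> nat \<Rightarrow> ('a list \<Rightarrow> 'c) \<Rightarrow> 'a list \<Rightarrow> 'c set \<Rightarrow> bool" where
  "focused A x n \<chi> f C \<longleftrightarrow> f \<in> words (insert x A) n \<and>
     (\<forall>c\<in>C. \<exists>\<tau>\<in>lines (insert x A) n. instantiate \<tau> x = f \<and> (\<forall>a\<in>A. \<chi> (instantiate \<tau> a) = c))"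

text \<open>Each focused line is concatenated with \<open>\<sigma>\<close>, both moving together;
  for letters of \<open>A\<close> the first block may be replaced by its value at \<open>a0\<close>,
  so the old colours survive. The new colour comes from moving \<open>\<sigma>\<close> alone in
  front of the constant word \<open>f\<close>.\<close>

lemma focused_step:
  assumes a0: "a0 \<in> A" and \<sigma>: "\<sigma> \<in> lines A m"
    and const: "\<And>a v. a \<in> A \<Longrightarrow> v \<in> words (insert x A) n \<Longrightarrow>
      \<chi> (instantiate \<sigma> a @ v) = \<chi> (instantiate \<sigma> a0 @ v)"
    and foc: "focused A x n (\<lambda>v. \<chi> (instantiate \<sigma> a0 @ v)) f C"
  shows "focused A x (m + n) \<chi> (instantiate \<sigma> x @ f) (insert (\<chi> (instantiate \<sigma> a0 @ f)) C)"
proof -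
  have \<sigma>': "\<sigma> \<in> lines (insert x A) m" using lines_mono[OF subset_insertI \<sigma>] .
  have f: "f \<in> words (insert x A) n" using foc by (simp add: focused_def)
  have "\<exists>\<tau>\<in>lines (insert x A) (m + n). instantiate \<tau> x = instantiate \<sigma> x @ f \<and>
      (\<forall>a\<in>A. \<chi> (instantiate \<tau> a) = c)" if c: "c \<in> C" for c
  proof -
    obtain \<tau> where \<tau>: "\<tau> \<in> lines (insert x A) n" "instantiate \<tau> x = f"
      "\<forall>a\<in>A. \<chi> (instantiate \<sigma> a0 @ instantiate \<tau> a) = c"
      using foc c by (auto simp: focused_def)
    then show ?thesis
      using const instantiate_words[OF \<tau>(1)]
      by (intro bexI[OF _ lines_append[OF \<sigma>' \<tau>(1)]]) (auto simp: instantiate_append)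
  qed
  moreover have "\<exists>\<tau>\<in>lines (insert x A) (m + n). instantiate \<tau> x = instantiate \<sigma> x @ f \<and>
      (\<forall>a\<in>A. \<chi> (instantiate \<tau> a) = \<chi> (instantiate \<sigma> a0 @ f))"
    using const f
    by (intro bexI[OF _ lines_append_word[OF \<sigma>' f]]) (auto simp: instantiate_append)
  ultimately show ?thesis
    using words_append[OF instantiate_words[OF \<sigma>'] f, of x] by (auto simp: focused_def)
qed

text \<open>A focused line with the colour of \<open>f\<close> keeps this colour at
  \<open>x\<close>, where it passes through \<open>f\<close>.\<close>

lemma focused_mono_line:
  assumes "focused A x n \<chi> f C" "\<chi> f \<in> C"
  shows "mono_line (insert x A) n \<chi>"
proof -
  obtain \<tau> where "\<tau> \<in> lines (insert x A) n" "instantiate \<tau> x = f"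
    "\<forall>a\<in>A. \<chi> (instantiate \<tau> a) = \<chi> f"
    using assms unfolding focused_def by blast
  then show ?thesis unfolding mono_line_def by auto
qed

text \<open>Induction on the number \<open>r\<close> of distinct focused colours. Each step prepends
  a block of coordinates, to which the theorem for the smaller alphabet \<open>A\<close> is
  applied.\<close>

lemma Hales_Jewett_focusing:
  assumes fin: "finite A" and ne: "A \<noteq> {}"
    and IH: "\<And>k. \<exists>n. \<forall>\<chi> :: 'a list \<Rightarrow> nat. \<chi> \<in> words A n \<rightarrow> {..<k} \<longrightarrow> mono_line A n \<chi>"
  shows "\<exists>n. \<forall>\<chi> \<in> words (insert x A) n \<rightarrow> {..<k::nat}. mono_line (insert x A) n \<chi> \<or>
           (\<exists>f C. C \<subseteq> {..<k} \<and> card C = r \<and> focused A x n \<chi> f C)"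
proof (induction r)
  case 0
  have "focused A x 0 \<chi> [] {}" for \<chi> :: "'a list \<Rightarrow> nat"
    by (simp add: focused_def words_def)
  then show ?case by (metis card.empty empty_subsetI)
next
  case (Suc r)
  let ?B = "insert x A"
  obtain n where n: "\<And>\<chi>. \<chi> \<in> words ?B n \<rightarrow> {..<k} \<Longrightarrow> mono_line ?B n \<chi> \<or>
           (\<exists>f C. C \<subseteq> {..<k} \<and> card C = r \<and> focused A x n \<chi> f C)"
    using Suc.IH by blast
  \<comment> \<open>A prefix \<open>u\<close> is coloured by the whole function that sends a suffix
    \<open>v\<close> to \<open>\<chi> (u @ v)\<close>.\<close>
  define K where "K = (words ?B n \<rightarrow>\<^sub>E {..<k})"
  have finK: "finite K" unfolding K_def using fin by (intro finite_PiE finite_words) auto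
  obtain m where m: "\<And>\<chi> :: 'a list \<Rightarrow> nat. \<chi> \<in> words A m \<rightarrow> {..<card K} \<Longrightarrow> mono_line A m \<chi>"
    using IH by blast
  have "mono_line ?B (m + n) \<chi> \<or>
      (\<exists>f C. C \<subseteq> {..<k} \<and> card C = Suc r \<and> focused A x (m + n) \<chi> f C)"
    if \<chi>: "\<chi> \<in> words ?B (m + n) \<rightarrow> {..<k}" for \<chi>
  proof -
    have in_k: "\<chi> (u @ v) < k" if "u \<in> words A m" "v \<in> words ?B n" for u v
      using \<chi> words_append[OF words_mono[OF subset_insertI that(1)] that(2)] by auto
    have "(\<lambda>u. \<lambda>v\<in>words ?B n. \<chi> (u @ v)) \<in> words A m \<rightarrow> K"
      unfolding K_def using in_k by auto
    from mono_line_finite_colours[OF m finK this]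
    obtain \<sigma> g where \<sigma>: "\<sigma> \<in> lines A m"
      and g: "\<And>a. a \<in> A \<Longrightarrow> (\<lambda>v\<in>words ?B n. \<chi> (instantiate \<sigma> a @ v)) = g"
      unfolding mono_line_def by auto
    obtain a0 where a0: "a0 \<in> A" using ne by blast
    have const: "\<chi> (instantiate \<sigma> a @ v) = \<chi> (instantiate \<sigma> a0 @ v)"
      if "a \<in> A" "v \<in> words ?B n" for a v
      using fun_cong[OF trans[OF g[OF that(1)] g[OF a0, symmetric]], of v] that(2) by simp
    let ?u = "instantiate \<sigma> a0" and ?\<chi> = "\<lambda>v. \<chi> (instantiate \<sigma> a0 @ v)"
    have u: "?u \<in> words A m" using instantiate_words[OF \<sigma> a0] .
    \<comment> \<open>Freezing the prefix turns a line in the last \<open>n\<close> coordinates into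
      one of length \<open>m + n\<close>.\<close>
    have lift: "mono_line ?B (m + n) \<chi>" if "mono_line ?B n ?\<chi>"
    proof -
      obtain \<tau> c where \<tau>: "\<tau> \<in> lines ?B n" "\<forall>a\<in>?B. \<chi> (?u @ instantiate \<tau> a) = c"
        using \<open>mono_line ?B n ?\<chi>\<close> unfolding mono_line_def by blast
      then show ?thesis
        unfolding mono_line_def
        by (intro bexI[OF _ lines_word_append[OF words_mono[OF subset_insertI u] \<tau>(1)]])
          (auto simp: instantiate_append)
    qed
    have "?\<chi> \<in> words ?B n \<rightarrow> {..<k}" using in_k u by auto
    from n[OF this] consider "mono_line ?B n ?\<chi>"
      | f C where "C \<subseteq> {..<k}" "card C = r" "focused A x n ?\<chi> f C" by blast
    then show ?thesis
    proof cases
      case 1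
      then show ?thesis using lift by blast
    next
      case 2
      \<comment> \<open>Either some focused line has the colour of its focus, or that colour is
        new.\<close>
      show ?thesis
      proof (cases "?\<chi> f \<in> C")
        case True
        then show ?thesis using focused_mono_line[OF 2(3)] lift by blast
      next
        case False
        have "f \<in> words ?B n" using 2(3) by (simp add: focused_def)
        then have "insert (?\<chi> f) C \<subseteq> {..<k}" using in_k u 2(1) by auto
        moreover have "card (insert (?\<chi> f) C) = Suc r"
          using False 2 finite_subset[OF 2(1)] by simp
        moreover note focused_step[OF a0 \<sigma> const 2(3)]
        ultimately show ?thesis by blast
      qed
    qed
  qed
  then show ?case by blast
qed

text \<open>Induction on the alphabet, with \<open>k\<close> arbitrary because focusing uses the
  smaller alphabet with far more colours. Only \<open>k\<close> colours exist, so focusing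
  \<open>k + 1\<close> of them is impossible and a monochromatic line remains.\<close>

theorem Hales_Jewett:
  assumes "finite A"
  shows "\<exists>n. \<forall>\<chi> :: 'a list \<Rightarrow> nat. \<chi> \<in> words A n \<rightarrow> {..<k} \<longrightarrow> mono_line A n \<chi>"
  using assms
proof (induction A arbitrary: k rule: finite_induct)
  case empty
  have "[None] \<in> lines {} 1" by (simp add: lines_def)
  then show ?case unfolding mono_line_def by blast
next
  case (insert x A)
  \<comment> \<open>Focusing needs a letter \<open>a0\<close> of \<open>A\<close>; over a one-letter
    alphabet every line is monochromatic.\<close>
  show ?case
  proof (cases "A = {}")
    case True
    have "[None] \<in> lines {x} 1" by (simp add: lines_def)
    then show ?thesis using True unfolding mono_line_def by blast
  next
    case False
    obtain n where n: "\<forall>\<chi> \<in> words (insert x A) n \<rightarrow> {..<k}.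
        mono_line (insert x A) n \<chi> \<or>
        (\<exists>f C. C \<subseteq> {..<k} \<and> card C = Suc k \<and> focused A x n \<chi> f C)"
      using Hales_Jewett_focusing[OF insert(1) False insert.IH, where x = x and r = "Suc k" and k = k]
      by (elim exE)
    have "\<not> (C \<subseteq> {..<k} \<and> card C = Suc k)" for C
      using card_mono[of "{..<k}" C] by auto
    then show ?thesis using n by blast
  qed
qed

subsection \<open>Partite systems\<close>

text \<open>A partial map stands for a partial transversal, with one vertex over each index of its
  domain. The map \<open>\<phi>\<close> acts on each part separately, so the projection
  \<open>dom s\<close> is kept.\<close>

definition map_image :: "('a \<Rightarrow> 'b \<Rightarrow> 'c) \<Rightarrow> ('a \<rightharpoonup> 'b) \<Rightarrow> ('a \<rightharpoonup> 'c)" where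
  "map_image \<phi> s = (\<lambda>i. map_option (\<phi> i) (s i))"

definition partite_embedding :: "('a \<Rightarrow> 'b \<Rightarrow> 'c) \<Rightarrow> 'b set \<Rightarrow> (('a \<rightharpoonup> 'b) \<Rightarrow> 't) \<Rightarrow>
    'c set \<Rightarrow> (('a \<rightharpoonup> 'c) \<Rightarrow> 't) \<Rightarrow> bool" where
  "partite_embedding \<phi> V t W u \<longleftrightarrow> (\<forall>i. \<phi> i ` V \<subseteq> W) \<and>
     (\<forall>s. ran s \<subseteq> V \<longrightarrow> u (map_image \<phi> s) = t s)"

text \<open>With \<open>\<alpha>\<close> the type of A carried to \<open>e\<close>, these are the
  copies of A that project onto \<open>e\<close>.\<close>

definition copies :: "'b set \<Rightarrow> (('a \<rightharpoonup> 'b) \<Rightarrow> 't) \<Rightarrow> 'a set \<Rightarrow> ('a set \<Rightarrow> 't) \<Rightarrow> ('a \<rightharpoonup> 'b) set" where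
  "copies V t e \<alpha> = {s. dom s = e \<and> ran s \<subseteq> V \<and> (\<forall>E\<subseteq>e. t (s |` E) = \<alpha> E)}"

lemma dom_map_image [simp]: "dom (map_image \<phi> s) = dom s"
  by (auto simp: map_image_def)

lemma ran_map_image: "\<forall>i. \<phi> i ` V \<subseteq> W \<Longrightarrow> ran s \<subseteq> V \<Longrightarrow> ran (map_image \<phi> s) \<subseteq> W"
  by (fastforce simp: map_image_def ran_def)

lemma map_image_restrict: "map_image \<phi> s |` E = map_image \<phi> (s |` E)"
  by (auto simp: map_image_def restrict_map_def)

lemma ran_restrict_subset: "ran (s |` E) \<subseteq> ran s"
  by (auto simp: ran_def restrict_map_def)

lemma map_image_comp: "map_image (\<lambda>i. \<psi> i \<circ> \<phi> i) s = map_image \<psi> (map_image \<phi> s)"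
  by (simp add: map_image_def option.map_comp)

lemma partite_embedding_comp:
  "partite_embedding \<phi> V t W u \<Longrightarrow> partite_embedding \<psi> W u X v \<Longrightarrow>
     partite_embedding (\<lambda>i. \<psi> i \<circ> \<phi> i) V t X v"
  unfolding partite_embedding_def map_image_comp
  by (auto simp: ran_map_image image_subset_iff)

lemma partite_embedding_copies:
  assumes \<phi>: "partite_embedding \<phi> V t W u" and s: "s \<in> copies V t e \<alpha>"
  shows "map_image \<phi> s \<in> copies W u e \<alpha>"
proof -
  have "ran (s |` E) \<subseteq> V" for E
    using s ran_restrict_subset[of s E] by (auto simp: copies_def)
  then show ?thesis
    using assms ran_map_image[of \<phi> V W s]
    by (simp add: copies_def partite_embedding_def map_image_restrict)
qed

lemma finite_copies:
  assumes "finite e" "finite V"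
  shows "finite (copies V t e \<alpha>)"
proof (rule finite_subset)
  show "copies V t e \<alpha> \<subseteq> {s. dom s = e \<and> ran s \<subseteq> V}" by (auto simp: copies_def)
  show "finite {s. dom s = e \<and> ran s \<subseteq> V}" using assms by (rule finite_set_of_finite_maps)
qed

text \<open>A vertex over \<open>i\<close> is a word in \<open>insert None (Some ` V)\<close>, and \<open>coord_map j S\<close> reads off the
  \<open>j\<close>-th letters of \<open>S\<close>, dropping the points where the letter is \<open>None\<close>.\<close>

definition coord_map :: "nat \<Rightarrow> ('a \<rightharpoonup> nat) \<Rightarrow> ('a \<rightharpoonup> nat)" where
  "coord_map j S = (\<lambda>i. Option.bind (S i) (\<lambda>x. (from_nat x :: nat option list) ! j))"

text \<open>Coordinates of type \<open>\<alpha>\<close> are neutral: on the image of a combinatorial line all other coordinates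
  carry the type of the point of the line, so it does not matter which one \<open>SOME\<close> picks.\<close>

definition word_type :: "nat \<Rightarrow> (('a \<rightharpoonup> nat) \<Rightarrow> 't) \<Rightarrow> ('a set \<Rightarrow> 't) \<Rightarrow> ('a \<rightharpoonup> nat) \<Rightarrow> 't" where
  "word_type n t \<alpha> S =
     (let good = (\<lambda>j. j < n \<and> dom (coord_map j S) = dom S \<and> t (coord_map j S) \<noteq> \<alpha> (dom S))
      in if \<exists>j. good j then t (coord_map (SOME j. good j) S) else \<alpha> (dom S))"

text \<open>A coordinate that \<open>SOME\<close> can pick is not neutral, so its type is
  \<open>x\<close>. If there is none, the witness \<open>j0\<close> is itself neutral, and
  \<open>x\<close> equals the default \<open>\<alpha> (dom S)\<close>.\<close>

lemma word_type_eq: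
  assumes neutral: "\<And>j. j < n \<Longrightarrow> dom (coord_map j S) = dom S \<Longrightarrow>
      t (coord_map j S) = \<alpha> (dom S) \<or> t (coord_map j S) = x"
    and witness: "j0 < n" "dom (coord_map j0 S) = dom S" "t (coord_map j0 S) = x"
  shows "word_type n t \<alpha> S = x"
proof -
  define good where
    "good j \<longleftrightarrow> j < n \<and> dom (coord_map j S) = dom S \<and> t (coord_map j S) \<noteq> \<alpha> (dom S)" for j
  have "t (coord_map (SOME j. good j) S) = x" if "\<exists>j. good j"
    using someI_ex[OF that] neutral unfolding good_def by blast
  moreover have "\<alpha> (dom S) = x" if "\<not> (\<exists>j. good j)"
    using that witness unfolding good_def by metis
  ultimately show ?thesis unfolding word_type_def Let_def good_def[symmetric] by simp
qed

text \<open>The vertex \<open>v\<close> fills the moving coordinates; a constant copy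
  \<open>s\<close> contributes its vertex over \<open>i\<close>, or a blank if \<open>i\<close> is
  outside its domain. Words are coded as numbers so that the next round again starts from vertices
  of type \<open>nat\<close>.\<close>

definition line_vertex :: "('a \<rightharpoonup> nat) option list \<Rightarrow> 'a \<Rightarrow> nat \<Rightarrow> nat" where
  "line_vertex \<tau> i v = to_nat (map (case_option (Some v) (\<lambda>s. s i)) \<tau>)"

lemma coord_map_line_vertex:
  assumes "j < length \<tau>"
  shows "coord_map j (map_image (line_vertex \<tau>) s) =
    (case \<tau> ! j of None \<Rightarrow> s | Some s' \<Rightarrow> s' |` dom s)"
proof
  fix i
  show "coord_map j (map_image (line_vertex \<tau>) s) i =
      (case \<tau> ! j of None \<Rightarrow> s | Some s' \<Rightarrow> s' |` dom s) i"
    using assms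
    by (cases "s i"; cases "\<tau> ! j")
      (auto simp: coord_map_def map_image_def line_vertex_def restrict_map_def)
qed

text \<open>A moving coordinate reads back \<open>s\<close> itself and witnesses the type
  \<open>t s\<close>. A constant coordinate keeps the full domain only if
  \<open>dom s \<subseteq> e\<close>; it then reads part of a copy and is neutral.\<close>

lemma line_vertex_embedding:
  assumes \<tau>: "\<tau> \<in> lines (copies V t e \<alpha>) n"
  shows "partite_embedding (line_vertex \<tau>) V t
    (to_nat ` words (insert None (Some ` V)) n) (word_type n t \<alpha>)"
proof -
  have len: "length \<tau> = n" and none: "None \<in> set \<tau>"
    and some: "\<And>s. Some s \<in> set \<tau> \<Longrightarrow> s \<in> copies V t e \<alpha>"
    using \<tau> by (auto simp: lines_def)
  have "line_vertex \<tau> i v \<in> to_nat ` words (insert None (Some ` V)) n" if v: "v \<in> V" for i v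
  proof -
    have "case_option (Some v) (\<lambda>s. s i) o' \<in> insert None (Some ` V)" if "o' \<in> set \<tau>" for o'
    proof (cases o')
      case (Some s)
      then have "ran s \<subseteq> V" using some that by (auto simp: copies_def)
      then show ?thesis using Some by (cases "s i") (auto intro: ranI)
    qed (use v in auto)
    then show ?thesis unfolding line_vertex_def words_def using len by (intro imageI) auto
  qed
  moreover have "word_type n t \<alpha> (map_image (line_vertex \<tau>) s) = t s" for s
  proof -
    let ?S = "map_image (line_vertex \<tau>) s"
    obtain j0 where j0: "j0 < n" "\<tau> ! j0 = None"
      using none len by (auto simp: in_set_conv_nth)
    have neutral: "t (coord_map j ?S) = \<alpha> (dom ?S) \<or> t (coord_map j ?S) = t s"
      if j: "j < n" "dom (coord_map j ?S) = dom ?S" for j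
    proof (cases "\<tau> ! j")
      case None
      then show ?thesis using j len by (simp add: coord_map_line_vertex)
    next
      case (Some s')
      have c: "coord_map j ?S = s' |` dom s" using Some j(1) len by (simp add: coord_map_line_vertex)
      have s': "s' \<in> copies V t e \<alpha>" using Some j(1) len some by (metis nth_mem)
      have "dom s \<subseteq> e" using j(2) s' unfolding c by (auto simp: copies_def)
      then show ?thesis using s' unfolding c by (simp add: copies_def)
    qed
    show ?thesis
      by (rule word_type_eq[where S = ?S and t = t and \<alpha> = \<alpha> and x = "t s",
            OF neutral j0(1)])
        (use j0 len in \<open>simp_all add: coord_map_line_vertex\<close>)
  qed
  ultimately show ?thesis unfolding partite_embedding_def by blast
qed

text \<open>\<open>W\<close> and \<open>u\<close> are fixed before the colouring; only
  \<open>\<phi>\<close> depends on it, through the monochromatic line.\<close>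

lemma partite_lemma:
  fixes t :: "('a \<rightharpoonup> nat) \<Rightarrow> 't"
  assumes "finite V" "finite e"
  shows "\<exists>W (u :: ('a \<rightharpoonup> nat) \<Rightarrow> 't). finite W \<and>
    (\<forall>\<chi>. (\<forall>s. \<chi> s < k) \<longrightarrow> (\<exists>\<phi> c. partite_embedding \<phi> V t W u \<and>
      (\<forall>s\<in>copies V t e \<alpha>. \<chi> (map_image \<phi> s) = (c::nat))))"
proof -
  let ?\<Lambda> = "copies V t e \<alpha>"
  obtain n where n: "\<And>\<chi> :: ('a \<rightharpoonup> nat) list \<Rightarrow> nat. \<chi> \<in> words ?\<Lambda> n \<rightarrow> {..<k} \<Longrightarrow> mono_line ?\<Lambda> n \<chi>"
    using Hales_Jewett[OF finite_copies[OF assms(2,1), of t \<alpha>], of k] by blast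
  let ?W = "to_nat ` words (insert None (Some ` V)) n"
  have "\<exists>\<phi> c. partite_embedding \<phi> V t ?W (word_type n t \<alpha>) \<and>
      (\<forall>s\<in>?\<Lambda>. \<chi> (map_image \<phi> s) = c)" if \<chi>: "\<forall>s. \<chi> s < k" for \<chi>
  proof -
    \<comment> \<open>A word of copies is read as one transversal over \<open>e\<close>: its vertex
      over \<open>i\<close> codes the word of their vertices over \<open>i\<close>. The points of a
      line thereby become the images of single copies under
      \<open>line_vertex \<tau>\<close>.\<close>
    define wm :: "('a \<rightharpoonup> nat) list \<Rightarrow> ('a \<rightharpoonup> nat)" where
      "wm w = (\<lambda>i. if i \<in> e then Some (to_nat (map (\<lambda>s. s i) w)) else None)" for w
    have "(\<chi> \<circ> wm) \<in> words ?\<Lambda> n \<rightarrow> {..<k}" using \<chi> by auto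
    from n[OF this] obtain \<tau> c where \<tau>: "\<tau> \<in> lines ?\<Lambda> n"
      and c: "\<And>s. s \<in> ?\<Lambda> \<Longrightarrow> \<chi> (wm (instantiate \<tau> s)) = c"
      by (auto simp: mono_line_def)
    have "map_image (line_vertex \<tau>) s = wm (instantiate \<tau> s)" if "s \<in> ?\<Lambda>" for s
    proof
      fix i
      show "map_image (line_vertex \<tau>) s i = wm (instantiate \<tau> s) i"
        using that
        by (cases "s i")
          (auto simp: map_image_def line_vertex_def wm_def instantiate_def copies_def
            split: option.split)
    qed
    then show ?thesis using c line_vertex_embedding[OF \<tau>] by auto
  qed
  moreover have "finite ?W" using assms(1) by (intro finite_imageI finite_words) auto
  ultimately show ?thesis by blast
qed

text \<open>The new set \<open>e\<close> is treated on top of the system obtained for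
  \<open>F\<close>. Constancy over \<open>e\<close> persists because the inner embedding maps copies
  over \<open>e\<close> to copies over \<open>e\<close>.\<close>

lemma partite_construction:
  fixes t :: "('a \<rightharpoonup> nat) \<Rightarrow> 't"
  assumes "finite F" "\<And>e. e \<in> F \<Longrightarrow> finite e" "finite V"
  shows "\<exists>W (u :: ('a \<rightharpoonup> nat) \<Rightarrow> 't). finite W \<and>
    (\<forall>\<chi>. (\<forall>s. \<chi> s < k) \<longrightarrow> (\<exists>\<phi>. partite_embedding \<phi> V t W u \<and>
      (\<forall>e\<in>F. \<exists>c. \<forall>s\<in>copies V t e (\<alpha> e). \<chi> (map_image \<phi> s) = (c::nat))))"
  using assms
proof (induction F rule: finite_induct)
  case empty
  have "partite_embedding (\<lambda>i v. v) V t V t"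
    by (auto simp: partite_embedding_def map_image_def option.map_ident)
  then show ?case using empty by blast
next
  case (insert e F)
  obtain W and u :: "('a \<rightharpoonup> nat) \<Rightarrow> 't" where W: "finite W"
    and u: "\<And>\<chi> :: ('a \<rightharpoonup> nat) \<Rightarrow> nat. \<forall>s. \<chi> s < k \<Longrightarrow> \<exists>\<phi>. partite_embedding \<phi> V t W u \<and>
      (\<forall>e\<in>F. \<exists>c. \<forall>s\<in>copies V t e (\<alpha> e). \<chi> (map_image \<phi> s) = c)"
    using insert.IH insert.prems by blast
  obtain X and v :: "('a \<rightharpoonup> nat) \<Rightarrow> 't" where X: "finite X"
    and v: "\<And>\<chi> :: ('a \<rightharpoonup> nat) \<Rightarrow> nat. \<forall>s. \<chi> s < k \<Longrightarrow> \<exists>\<phi> c. partite_embedding \<phi> W u X v \<and>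
      (\<forall>s\<in>copies W u e (\<alpha> e). \<chi> (map_image \<phi> s) = c)"
    using partite_lemma[OF W, of e k u "\<alpha> e"] insert.prems by blast
  have "\<exists>\<phi>. partite_embedding \<phi> V t X v \<and>
      (\<forall>e\<in>insert e F. \<exists>c. \<forall>s\<in>copies V t e (\<alpha> e). \<chi> (map_image \<phi> s) = c)"
    if \<chi>: "\<forall>s. \<chi> s < k" for \<chi> :: "('a \<rightharpoonup> nat) \<Rightarrow> nat"
  proof -
    \<comment> \<open>The outer embedding is chosen first; the colouring pulled back along it is
      then given to the system for \<open>F\<close>.\<close>
    obtain \<psi> c where \<psi>: "partite_embedding \<psi> W u X v"
      and c: "\<forall>s\<in>copies W u e (\<alpha> e). \<chi> (map_image \<psi> s) = c"
      using v[OF \<chi>] by blast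
    obtain \<phi> where \<phi>: "partite_embedding \<phi> V t W u"
      and F: "\<forall>e\<in>F. \<exists>c. \<forall>s\<in>copies V t e (\<alpha> e). \<chi> (map_image \<psi> (map_image \<phi> s)) = c"
      using u[of "\<lambda>s. \<chi> (map_image \<psi> s)"] \<chi> by blast
    have "\<forall>s\<in>copies V t e (\<alpha> e). \<chi> (map_image \<psi> (map_image \<phi> s)) = c"
      using c partite_embedding_copies[OF \<phi>] by blast
    then show ?thesis
      using F partite_embedding_comp[OF \<phi> \<psi>]
      by (intro exI[of _ "\<lambda>i. \<psi> i \<circ> \<phi> i"]) (auto simp: map_image_comp)
  qed
  then show ?case using X by blast
qed

section \<open>Ranks, and a Ramsey theorem for types on subsets of an ordered set\<close>

definition rank :: "nat set \<Rightarrow> nat \<Rightarrow> nat" where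
  "rank E x = card {y \<in> E. y < x}"

lemma rank_image:
  assumes "strict_mono_on {..<n} h" "i < n"
  shows "rank (h ` {..<n}) (h i) = i"
proof -
  have "{y \<in> h ` {..<n}. y < h i} = h ` {..<i}"
    using assms by (auto simp: strict_mono_on_less)
  moreover have "inj_on h {..<i}"
    using strict_mono_on_imp_inj_on[OF assms(1)] assms(2) by (auto intro: inj_on_subset)
  ultimately show ?thesis by (simp add: rank_def card_image)
qed

lemma rank_image_subset:
  assumes h: "strict_mono_on {..<n} h" and E: "E \<subseteq> {..<n}"
  shows "rank (h ` {..<n}) ` h ` E = E"
  using rank_image[OF h] E by (force simp: image_image)

text \<open>\<open>\<alpha>\<close> and \<open>\<beta>\<close> are the types of A and B along their
  orders, \<open>f\<close> runs over the embeddings of A into B as index maps, and \<open>d\<close>,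
  \<open>g\<close> give the indices and vertices of a copy of B.\<close>

theorem ordered_type_Ramsey:
  fixes \<alpha> \<beta> :: "nat set \<Rightarrow> 't" and k :: nat
  shows "\<exists>p V (t :: (nat \<rightharpoonup> nat) \<Rightarrow> 't). finite V \<and>
    (\<forall>\<chi>. (\<forall>s. \<chi> s < k) \<longrightarrow> (\<exists>d g c. strict_mono_on {..<b} d \<and> d ` {..<b} \<subseteq> {..<p::nat} \<and>
       g ` d ` {..<b} \<subseteq> V \<and> (\<forall>E\<subseteq>{..<b}. t ((Some \<circ> g) |` (d ` E)) = \<beta> E) \<and>
       (\<forall>f. strict_mono_on {..<a} f \<longrightarrow> f ` {..<a} \<subseteq> {..<b} \<longrightarrow> (\<forall>E\<subseteq>{..<a}. \<beta> (f ` E) = \<alpha> E) \<longrightarrow>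
          \<chi> ((Some \<circ> g) |` (d ` f ` {..<a})) = c)))"
proof -
  obtain p where p: "partn_lst {..<p::nat} (replicate k b) a"
    using ramsey_full by blast
  \<comment> \<open>A vertex is the code of a subset of \<open>{..<p}\<close>; the constant
    transversal over a \<open>b\<close>-subset \<open>H\<close> at the code of \<open>H\<close> is
    the copy of B over \<open>H\<close>.\<close>
  define V where "V = set_encode ` Pow {..<p}"
  \<comment> \<open>One value of \<open>S\<close> is decoded to a set, and the ranks of
    \<open>dom S\<close> in that set tell which part of B is seen.\<close>
  define t where "t S = \<beta> (rank (set_decode (SOME x. x \<in> ran S)) ` dom S)" for S :: "nat \<rightharpoonup> nat"
  define F where "F = nsets {..<p} a"
  have "finite V" "finite F" "\<And>e. e \<in> F \<Longrightarrow> finite e"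
    unfolding V_def F_def by (auto simp: nsets_def finite_imp_finite_nsets)
  \<comment> \<open>Ranks carry \<open>\<alpha>\<close> from \<open>{..<a}\<close> to each
    \<open>a\<close>-subset \<open>e\<close>.\<close>
  from partite_construction[OF this(2,3,1), of k t "\<lambda>e E. \<alpha> (rank e ` E)"]
  obtain W and u :: "(nat \<rightharpoonup> nat) \<Rightarrow> 't" where W: "finite W"
    and u: "\<And>\<chi> :: (nat \<rightharpoonup> nat) \<Rightarrow> nat. \<forall>s. \<chi> s < k \<Longrightarrow> \<exists>\<phi>. partite_embedding \<phi> V t W u \<and>
      (\<forall>e\<in>F. \<exists>c. \<forall>s\<in>copies V t e (\<lambda>E. \<alpha> (rank e ` E)). \<chi> (map_image \<phi> s) = c)"
    by blast
  have "\<exists>d g c. strict_mono_on {..<b} d \<and> d ` {..<b} \<subseteq> {..<p} \<and>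
       g ` d ` {..<b} \<subseteq> W \<and> (\<forall>E\<subseteq>{..<b}. u ((Some \<circ> g) |` (d ` E)) = \<beta> E) \<and>
       (\<forall>f. strict_mono_on {..<a} f \<longrightarrow> f ` {..<a} \<subseteq> {..<b} \<longrightarrow> (\<forall>E\<subseteq>{..<a}. \<beta> (f ` E) = \<alpha> E) \<longrightarrow>
          \<chi> ((Some \<circ> g) |` (d ` f ` {..<a})) = c)"
    if \<chi>: "\<forall>s. \<chi> s < k" for \<chi>
  proof -
    obtain \<phi> where \<phi>: "partite_embedding \<phi> V t W u"
      and mono: "\<And>e. e \<in> F \<Longrightarrow>
        \<exists>c. \<forall>s\<in>copies V t e (\<lambda>E. \<alpha> (rank e ` E)). \<chi> (map_image \<phi> s) = c"
      using u[OF \<chi>] by blast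
    \<comment> \<open>If there is no copy over \<open>e\<close>, the constant from
      \<open>mono\<close> is arbitrary, and any value of \<open>\<chi>\<close> serves as a colour
      below \<open>k\<close>.\<close>
    have "\<exists>c<k. \<forall>s\<in>copies V t e (\<lambda>E. \<alpha> (rank e ` E)). \<chi> (map_image \<phi> s) = c" if "e \<in> F" for e
      using mono[OF that] \<chi> by (metis (no_types, lifting))
    then obtain col where col: "\<And>e. e \<in> F \<Longrightarrow> col e < k"
      "\<And>e s. e \<in> F \<Longrightarrow> s \<in> copies V t e (\<lambda>E. \<alpha> (rank e ` E)) \<Longrightarrow> \<chi> (map_image \<phi> s) = col e"
      by metis
    have "col \<in> nsets {..<p} a \<rightarrow> {..<k}" using col(1) unfolding F_def by auto
    from partn_lstE[OF p this length_replicate] obtain i H where "i < k"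
      "H \<in> nsets {..<p} (replicate k b ! i)" and i: "col ` nsets H a \<subseteq> {i}"
      by (metis length_replicate)
    then have H: "H \<in> nsets {..<p} b" by simp
    have H': "H \<subseteq> {..<p}" "finite H" "card H = b" using H by (auto simp: nsets_def)
    obtain d where d: "bij_betw d {..<b} H" "strict_mono_on {..<b} d"
      using ex_bij_betw_strict_mono_card[OF H'(2)] H'(3) by blast
    have dH: "d ` {..<b} = H" using d(1) by (simp add: bij_betw_def)
    define s0 where "s0 E = (\<lambda>i. Some (set_encode H)) |` E" for E :: "nat set"
    have ran: "ran (s0 E) \<subseteq> V" for E
      using H' by (auto simp: s0_def V_def ran_def restrict_map_def split: if_splits)
    have dom: "dom (s0 E) = E" for E by (auto simp: s0_def restrict_map_def split: if_splits)
    have t: "t (s0 (d ` E)) = \<beta> E" if "E \<subseteq> {..<b}" for E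
    proof (cases "E = {}")
      \<comment> \<open>Here \<open>SOME\<close> chooses from an empty range, but the image of the
        empty domain is empty whatever set is decoded.\<close>
      case True
      then show ?thesis by (simp add: t_def s0_def)
    next
      case False
      then have "ran (s0 (d ` E)) = {set_encode H}"
        by (auto simp: s0_def ran_def restrict_map_def)
      then show ?thesis
        using rank_image_subset[OF d(2) that] H'(2) by (simp add: t_def dom dH)
    qed
    define g where "g i = \<phi> i (set_encode H)" for i
    have img: "map_image \<phi> (s0 E) = (Some \<circ> g) |` E" for E
      by (auto simp: map_image_def s0_def g_def restrict_map_def)
    have "set_encode H \<in> V" using H'(1) by (simp add: V_def)
    then have "g ` d ` {..<b} \<subseteq> W"
      using \<phi> unfolding partite_embedding_def g_def by blast
    moreover have "u ((Some \<circ> g) |` (d ` E)) = \<beta> E" if "E \<subseteq> {..<b}" for E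
      using \<phi> ran t[OF that] unfolding img[symmetric] by (simp add: partite_embedding_def)
    moreover have "\<chi> ((Some \<circ> g) |` (d ` f ` {..<a})) = i"
      if f: "strict_mono_on {..<a} f" "f ` {..<a} \<subseteq> {..<b}" "\<forall>E\<subseteq>{..<a}. \<beta> (f ` E) = \<alpha> E" for f
    proof -
      have df: "strict_mono_on {..<a} (d \<circ> f)"
        using f(1,2) d(2) by (auto simp: strict_mono_on_def image_subset_iff)
      \<comment> \<open>The projection of the given copy of A is an \<open>a\<close>-subset of
        \<open>H\<close>, hence \<open>col e = i\<close>.\<close>
      define e where "e = (d \<circ> f) ` {..<a}"
      have "e \<subseteq> H" unfolding e_def using f(2) dH by auto
      moreover have "card e = a"
        unfolding e_def using card_image[OF strict_mono_on_imp_inj_on[OF df]] by simp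
      ultimately have e: "e \<in> nsets H a" using H'(2) by (auto simp: nsets_def intro: finite_subset)
      then have eF: "e \<in> F" using H'(1) nsets_mono[of H "{..<p}" a] unfolding F_def by auto
      have "t (s0 e |` E) = \<alpha> (rank e ` E)" if E: "E \<subseteq> e" for E
      proof -
        obtain E' where E': "E' \<subseteq> {..<a}" "E = (d \<circ> f) ` E'"
          by (rule subset_imageE[OF E[unfolded e_def]])
        have "s0 e |` E = s0 (d ` f ` E')"
          using E E'(2) by (auto simp: s0_def image_comp Int_absorb1)
        moreover have "rank e ` E = E'"
          unfolding e_def E'(2) using rank_image_subset[OF df E'(1)] .
        moreover have "f ` E' \<subseteq> {..<b}" using E'(1) f(2) by auto
        ultimately show ?thesis using t f(3) E'(1) by simp
      qed
      then have "s0 e \<in> copies V t e (\<lambda>E. \<alpha> (rank e ` E))"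
        by (simp add: copies_def dom ran)
      from col(2)[OF eF this] i e show ?thesis
        unfolding img e_def by (auto simp: image_comp)
    qed
    ultimately show ?thesis using d(2) dH H'(1) by blast
  qed
  then show ?thesis using W by blast
qed

lemma rank_less: "finite E \<Longrightarrow> x \<in> E \<Longrightarrow> x < y \<Longrightarrow> rank E x < rank E y"
  unfolding rank_def by (rule psubset_card_mono) auto

lemma inj_on_rank: "finite E \<Longrightarrow> inj_on (rank E) E"
  by (rule linorder_inj_onI') (metis rank_less less_irrefl)

lemma rank_strict_mono_image:
  assumes f: "strict_mono_on S f" and E: "E \<subseteq> S" and x: "x \<in> E"
  shows "rank (f ` E) (f x) = rank E x"
proof -
  have "{y \<in> f ` E. y < f x} = f ` {y \<in> E. y < x}"
    using E x by (auto simp: strict_mono_on_less[OF f] subset_iff)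
  moreover have "inj_on f {y \<in> E. y < x}"
    using strict_mono_on_imp_inj_on[OF f] E by (auto intro: inj_on_subset)
  ultimately show ?thesis by (simp add: rank_def card_image)
qed

subsection \<open>Ordered relational structures\<close>

text \<open>The number of predecessors increases strictly along \<open>r\<close>, so it is a
  bijection onto \<open>{..<card U}\<close>; its inverse enumerates \<open>U\<close>.\<close>

lemma strict_linear_order_enumeration:
  assumes "finite U" and r: "strict_linear_order_on U r"
  obtains a where "bij_betw a {..<card U} U"
    "\<And>i j. i < card U \<Longrightarrow> j < card U \<Longrightarrow> (a i, a j) \<in> r \<longleftrightarrow> i < j"
proof -
  define h where "h x = card {y \<in> U. (y, x) \<in> r}" for x
  have tr: "trans r" and irr: "\<And>x. (x, x) \<notin> r" and tot: "total_on U r"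
    using r by (auto simp: strict_linear_order_on_def irrefl_def)
  have h_less: "h x < h y" if "(x, y) \<in> r" "x \<in> U" for x y
  proof -
    have "{z \<in> U. (z, x) \<in> r} \<subset> {z \<in> U. (z, y) \<in> r}"
      using that irr transD[OF tr] by blast
    then show ?thesis unfolding h_def using \<open>finite U\<close> by (intro psubset_card_mono) auto
  qed
  have "h x < card U" if "x \<in> U" for x
    unfolding h_def using that irr \<open>finite U\<close> by (intro psubset_card_mono) auto
  then have sub: "h ` U \<subseteq> {..<card U}" by auto
  have inj: "inj_on h U"
  proof (rule inj_onI, rule ccontr)
    fix x y assume "x \<in> U" "y \<in> U" "h x = h y" "x \<noteq> y"
    then show False using tot h_less[of x y] h_less[of y x] by (auto simp: total_on_def)
  qed
  have bij: "bij_betw h U {..<card U}"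
    using card_subset_eq[OF _ sub] inj by (simp add: bij_betw_def card_image)
  define a where "a = inv_into U h"
  have a: "bij_betw a {..<card U} U" unfolding a_def using bij by (rule bij_betw_inv_into)
  have ha: "h (a i) = i" if "i < card U" for i
    unfolding a_def using bij that by (simp add: bij_betw_inv_into_right)
  have "(a i, a j) \<in> r \<longleftrightarrow> i < j" if ij: "i < card U" "j < card U" for i j
  proof
    have mem: "a i \<in> U" "a j \<in> U" using ij bij_betwE[OF a] by auto
    show "i < j" if "(a i, a j) \<in> r" using h_less[OF that mem(1)] ha ij by simp
    show "(a i, a j) \<in> r" if "i < j"
    proof -
      have "a i \<noteq> a j" using ha[OF ij(1)] ha[OF ij(2)] that by auto
      moreover have "(a j, a i) \<notin> r"
      proof
        assume "(a j, a i) \<in> r"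
        from h_less[OF this mem(2)] show False
          unfolding ha[OF ij(1)] ha[OF ij(2)] using that by simp
      qed
      ultimately show ?thesis using tot mem unfolding total_on_def by blast
    qed
  qed
  then show thesis using that a by blast
qed

definition enumerates :: "'r \<Rightarrow> (nat \<Rightarrow> 'u) \<Rightarrow> ('r, 'u) rel_structure \<Rightarrow> bool" where
  "enumerates lt a A \<longleftrightarrow> bij_betw a {..<card (univ A)} (univ A) \<and>
     (\<forall>i<card (univ A). \<forall>j<card (univ A). [a i, a j] \<in> interp A lt \<longleftrightarrow> i < j)"

lemma ex_enumerates:
  assumes "finite (univ A)" "linearly_ordered_structure \<Theta> ar lt A"
  shows "\<exists>a. enumerates lt a A"
proof -
  have "strict_linear_order_on (univ A) {(x, y). [x, y] \<in> interp A lt}"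
    using assms(2) by (simp add: linearly_ordered_structure_def)
  from strict_linear_order_enumeration[OF assms(1) this] show ?thesis
    unfolding enumerates_def by (metis (no_types, lifting) case_prodD case_prodI mem_Collect_eq)
qed

text \<open>Replacing a set of indices by its ranks makes the type independent of the ambient structure,
  and only tuples that exhaust \<open>E\<close> count, so that one colour per subset encodes relations of all
  arities, however many there are.\<close>

definition induced_type :: "'r set \<Rightarrow> ('r \<Rightarrow> nat) \<Rightarrow> (nat \<Rightarrow> 'u) \<Rightarrow> ('r, 'u) rel_structure \<Rightarrow>
    nat set \<Rightarrow> ('r \<times> nat list) set" where
  "induced_type \<Theta> ar a A E =
     {(R, map (rank E) xs) | R xs. R \<in> \<Theta> \<and> length xs = ar R \<and> set xs = E \<and> map a xs \<in> interp A R}"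

text \<open>Ranks are injective on \<open>set xs\<close>, so the ranked tuple determines
  \<open>xs\<close>.\<close>

lemma mem_induced_type:
  assumes "R \<in> \<Theta>" "length xs = ar R"
  shows "(R, map (rank (set xs)) xs) \<in> induced_type \<Theta> ar a A (set xs) \<longleftrightarrow> map a xs \<in> interp A R"
proof
  assume "(R, map (rank (set xs)) xs) \<in> induced_type \<Theta> ar a A (set xs)"
  then obtain ys where ys: "map (rank (set xs)) xs = map (rank (set xs)) ys" "set ys = set xs"
    "map a ys \<in> interp A R" by (auto simp: induced_type_def)
  have "xs = ys" using ys(1,2) inj_on_rank[of "set xs"] by (auto dest: map_inj_on)
  then show "map a xs \<in> interp A R" using ys(3) by simp
qed (use assms in \<open>auto simp: induced_type_def\<close>)

text \<open>Here \<open>f\<close> is \<open>\<phi>\<close> read on indices. Increasing maps keep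
  ranks, and embeddings preserve and reflect relations; this yields the condition on
  \<open>f\<close> in \<open>ordered_type_Ramsey\<close>.\<close>

lemma induced_type_embedding:
  assumes \<phi>: "\<phi> \<in> embeddings L ar A B" and "\<Theta> \<subseteq> L"
    and a: "a ` S \<subseteq> univ A" and f: "strict_mono_on S f"
    and comm: "\<And>i. i \<in> S \<Longrightarrow> \<phi> (a i) = b (f i)" and E: "E \<subseteq> S"
  shows "induced_type \<Theta> ar b B (f ` E) = induced_type \<Theta> ar a A E"
proof -
  have inj: "inj_on f E" using strict_mono_on_imp_inj_on[OF f] E by (rule inj_on_subset)
  have step: "map b (map f xs) \<in> interp B R \<longleftrightarrow> map a xs \<in> interp A R"
    "map (rank (f ` E)) (map f xs) = map (rank E) xs"
    if "R \<in> \<Theta>" "length xs = ar R" "set xs = E" for R xs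
  proof -
    have "map b (map f xs) = map \<phi> (map a xs)" using comm E that(3) by auto
    moreover have "set (map a xs) \<subseteq> univ A" using a E that(3) by auto
    ultimately show "map b (map f xs) \<in> interp B R \<longleftrightarrow> map a xs \<in> interp A R"
      using \<phi> \<open>\<Theta> \<subseteq> L\<close> that(1,2) by (auto simp: embeddings_def subset_iff simp del: map_map)
    show "map (rank (f ` E)) (map f xs) = map (rank E) xs"
      using rank_strict_mono_image[OF f E] that(3) by auto
  qed
  show ?thesis
  proof (intro set_eqI iffI)
    fix q assume "q \<in> induced_type \<Theta> ar a A E"
    then obtain R xs where q: "q = (R, map (rank E) xs)" "R \<in> \<Theta>" "length xs = ar R" "set xs = E"
      "map a xs \<in> interp A R" by (auto simp: induced_type_def)
    then show "q \<in> induced_type \<Theta> ar b B (f ` E)"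
      using step[OF q(2-4)] unfolding induced_type_def
      by (intro CollectI exI[of _ R] exI[of _ "map f xs"]) (simp del: map_map)
  next
    fix q assume "q \<in> induced_type \<Theta> ar b B (f ` E)"
    then obtain R ys where q: "q = (R, map (rank (f ` E)) ys)" "R \<in> \<Theta>" "length ys = ar R"
      "set ys = f ` E" "map b ys \<in> interp B R" by (auto simp: induced_type_def)
    \<comment> \<open>A tuple that exhausts the image of \<open>E\<close> is pulled back along
      \<open>f\<close>, which is injective on \<open>E\<close>.\<close>
    define xs where "xs = map (inv_into E f) ys"
    have ys: "ys = map f xs"
      unfolding xs_def using q(4) by (auto simp: comp_def f_inv_into_f intro!: map_idI[symmetric])
    have "length xs = ar R" "set xs = E"
      unfolding xs_def using q(3,4) inj by (auto simp: image_image)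
    then show "q \<in> induced_type \<Theta> ar a A E"
      using step[OF q(2), of xs] q(1,2,5) unfolding induced_type_def ys
      by (intro CollectI exI[of _ R] exI[of _ xs]) (simp del: map_map)
  qed
qed

section \<open>Ordered structures decoded from partite systems\<close>

definition lex_less :: "nat \<times> nat \<Rightarrow> nat \<times> nat \<Rightarrow> bool" where
  "lex_less x y \<longleftrightarrow> fst x < fst y \<or> fst x = fst y \<and> snd x < snd y"

text \<open>Points are pairs of an index and a vertex, ordered by index first. The relations undo
  \<open>induced_type\<close>: the entries of a tuple must form a transversal \<open>s\<close>, and
  \<open>t s\<close> decides on the ranked tuple of indices.\<close>

definition partite_structure :: "'r set \<Rightarrow> ('r \<Rightarrow> nat) \<Rightarrow> 'r \<Rightarrow> (nat \<times> nat \<Rightarrow> 'u) \<Rightarrow>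
    (nat \<times> nat) set \<Rightarrow> ((nat \<rightharpoonup> nat) \<Rightarrow> ('r \<times> nat list) set) \<Rightarrow> ('r, 'u) rel_structure" where
  "partite_structure \<Theta> ar lt \<iota> P t =
     \<lparr>univ = \<iota> ` P,
      interp = (\<lambda>R. if R = lt then {[\<iota> x, \<iota> y] | x y. x \<in> P \<and> y \<in> P \<and> lex_less x y}
        else if R \<in> \<Theta> then {map \<iota> ps | ps. length ps = ar R \<and> set ps \<subseteq> P \<and>
          (\<exists>s. Map.graph s = set ps \<and> (R, map (rank (dom s) \<circ> fst) ps) \<in> t s)}
        else {})\<rparr>"

lemma linearly_ordered_partite_structure:
  assumes "inj \<iota>" "ar lt = 2"
  shows "linearly_ordered_structure \<Theta> ar lt (partite_structure \<Theta> ar lt \<iota> P t)"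
proof -
  let ?r = "{(x, y). [x, y] \<in> interp (partite_structure \<Theta> ar lt \<iota> P t) lt}"
  have r: "?r = {(\<iota> x, \<iota> y) | x y. x \<in> P \<and> y \<in> P \<and> lex_less x y}"
    by (auto simp: partite_structure_def)
  have "trans ?r" unfolding r
    using injD[OF assms(1)] by (auto simp: trans_def lex_less_def) fastforce+
  moreover have "irrefl ?r" unfolding r
    using injD[OF assms(1)] by (fastforce simp: irrefl_def lex_less_def)
  moreover have "total_on (\<iota> ` P) ?r" unfolding r total_on_def lex_less_def
    by (auto simp: prod_eq_iff) (metis fst_conv snd_conv linorder_neqE_nat)+
  ultimately have "strict_linear_order_on (\<iota> ` P) ?r"
    by (simp add: strict_linear_order_on_def)
  moreover have "is_structure (insert lt \<Theta>) ar (partite_structure \<Theta> ar lt \<iota> P t)"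
    using assms(2) by (auto simp: is_structure_def partite_structure_def subset_iff)
  ultimately show ?thesis
    by (simp add: linearly_ordered_structure_def partite_structure_def)
qed

lemma graph_Some_restrict: "Map.graph ((Some \<circ> g) |` D) = (\<lambda>i. (i, g i)) ` D"
  by (auto simp: Map.graph_def restrict_map_def split: if_splits)

lemma dom_Some_restrict: "dom ((Some \<circ> g) |` D) = D"
  by (auto simp: restrict_map_def split: if_splits)

lemma graph_inject: "Map.graph s = Map.graph s' \<Longrightarrow> s = s'"
  by (rule ext) (metis in_graphD in_graphI not_Some_eq)

text \<open>As \<open>d\<close> increases, the lexicographic order on the image agrees with that of
  \<open>B\<close>. The image of a tuple forms the graph of exactly one transversal, a restriction
  of \<open>g\<close>, whose type is by hypothesis the one induced by \<open>B\<close>.\<close>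

lemma partite_structure_embedding:
  fixes B :: "('r, 'u) rel_structure" and \<iota> :: "nat \<times> nat \<Rightarrow> 'v"
  assumes \<iota>: "inj \<iota>" and lt: "ar lt = 2" "lt \<notin> \<Theta>" and b: "enumerates lt b B"
    and d: "strict_mono_on {..<card (univ B)} d"
    and P: "(\<lambda>i. (i, g i)) ` d ` {..<card (univ B)} \<subseteq> P"
    and t: "\<And>E. E \<subseteq> {..<card (univ B)} \<Longrightarrow> t ((Some \<circ> g) |` (d ` E)) = induced_type \<Theta> ar b B E"
    and w: "w \<in> extensional (univ B)" "\<And>j. j < card (univ B) \<Longrightarrow> w (b j) = \<iota> (d j, g (d j))"
  shows "w \<in> embeddings (insert lt \<Theta>) ar B (partite_structure \<Theta> ar lt \<iota> P t)"
proof -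
  let ?C = "partite_structure \<Theta> ar lt \<iota> P t" and ?m = "card (univ B)"
  have bij: "bij_betw b {..<?m} (univ B)"
    and ltB: "\<And>i j. i < ?m \<Longrightarrow> j < ?m \<Longrightarrow> [b i, b j] \<in> interp B lt \<longleftrightarrow> i < j"
    using b by (auto simp: enumerates_def)
  have index: "\<exists>j<?m. x = b j" if "x \<in> univ B" for x
    using that bij by (auto simp: bij_betw_def)
  have \<iota>_eq: "\<iota> x = \<iota> y \<longleftrightarrow> x = y" for x y using \<iota> by (auto dest: injD)
  have d_less: "d i < d j \<longleftrightarrow> i < j" "d i = d j \<longleftrightarrow> i = j" if "i < ?m" "j < ?m" for i j
    using strict_mono_on_less[OF d] strict_mono_on_eq[OF d] that by auto
  have memP: "(d j, g (d j)) \<in> P" if "j < ?m" for j using P that by auto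
  have "w x \<in> univ ?C" if "x \<in> univ B" for x
    using index[OF that] w(2) memP by (auto simp: partite_structure_def)
  moreover have "inj_on w (univ B)"
  proof (rule inj_onI)
    fix x y assume "x \<in> univ B" "y \<in> univ B" "w x = w y"
    moreover from this obtain i j where "i < ?m" "x = b i" "j < ?m" "y = b j"
      using index by metis
    ultimately show "x = y" using w(2) by (auto simp: \<iota>_eq d_less)
  qed
  moreover have "xs \<in> interp B R \<longleftrightarrow> map w xs \<in> interp ?C R"
    if R: "R \<in> insert lt \<Theta>" and xs: "length xs = ar R" "set xs \<subseteq> univ B" for R xs
  proof -
    let ?b' = "inv_into {..<?m} b"
    have "set (map ?b' xs) \<subseteq> {..<?m}"
      using bij_betwE[OF bij_betw_inv_into[OF bij]] xs(2) by auto
    moreover have "xs = map b (map ?b' xs)"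
      using bij_betw_inv_into_right[OF bij] xs(2) by (auto intro!: map_idI[symmetric])
    ultimately obtain js where js: "set js \<subseteq> {..<?m}" "xs = map b js" by blast
    let ?ps = "map (\<lambda>j. (d j, g (d j))) js"
    have wxs: "map w xs = map \<iota> ?ps" using js w(2) by auto
    show ?thesis
    proof (cases "R = lt")
      case True
      then obtain i j where "js = [i, j]"
        using xs(1) js(2) lt(1) by (auto simp: numeral_2_eq_2 length_Suc_conv)
      then show ?thesis
        using True js ltB memP unfolding wxs
        by (auto simp: partite_structure_def \<iota>_eq lex_less_def d_less)
    next
      case False
      then have R: "R \<in> \<Theta>" using R by simp
      have len: "length js = ar R" using js(2) xs(1) by simp
      let ?s = "(Some \<circ> g) |` (d ` set js)"
      have ps: "set ?ps \<subseteq> P" using js(1) memP by auto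
      have gr: "Map.graph ?s = set ?ps" by (auto simp: graph_Some_restrict image_image)
      have graph: "Map.graph s = set ?ps \<longleftrightarrow> s = ?s" for s
        unfolding gr[symmetric] by (rule iffI[OF graph_inject]) simp_all
      \<comment> \<open>Ranks do not change from indices in \<open>B\<close> to indices of parts,
        since \<open>d\<close> is increasing.\<close>
      have rk: "map (rank (dom ?s) \<circ> fst) ?ps = map (rank (set js)) js"
        unfolding dom_Some_restrict using rank_strict_mono_image[OF d js(1)] by auto
      have "map w xs \<in> interp ?C R \<longleftrightarrow> (\<exists>s. Map.graph s = set ?ps \<and>
          (R, map (rank (dom s) \<circ> fst) ?ps) \<in> t s)"
        unfolding wxs using False R len ps inj_map_eq_map[OF \<iota>]
        by (auto simp: partite_structure_def simp del: map_map)
      also have "\<dots> \<longleftrightarrow> (R, map (rank (dom ?s) \<circ> fst) ?ps) \<in> t ?s"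
        unfolding graph by simp
      also have "\<dots> \<longleftrightarrow> map b js \<in> interp B R"
        unfolding rk t[OF js(1)] by (rule mem_induced_type[of R \<Theta> js ar b B, OF R len])
      finally show ?thesis using js(2) by simp
    qed
  qed
  ultimately show ?thesis using w(1) by (auto simp: embeddings_def PiE_def)
qed

text \<open>Monotonicity of \<open>f\<close> is preservation of \<open>lt\<close>, read through the
  enumerations.\<close>

lemma embedding_indices:
  assumes \<phi>: "\<phi> \<in> embeddings (insert lt \<Theta>) ar A B" and "ar lt = 2"
    and a: "enumerates lt a A" and b: "enumerates lt b B"
  obtains f where "strict_mono_on {..<card (univ A)} f" "f ` {..<card (univ A)} \<subseteq> {..<card (univ B)}"
    "\<And>j. j < card (univ A) \<Longrightarrow> \<phi> (a j) = b (f j)"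
proof -
  let ?n = "card (univ A)" and ?m = "card (univ B)"
  have a': "a j \<in> univ A" if "j < ?n" for j
    using a that by (auto simp: enumerates_def dest: bij_betwE)
  have "\<exists>i<?m. \<phi> (a j) = b i" if "j < ?n" for j
  proof -
    have "\<phi> (a j) \<in> univ B" using \<phi> a'[OF that] by (auto simp: embeddings_def)
    then show ?thesis using b by (auto simp: enumerates_def bij_betw_def)
  qed
  then obtain f where f: "\<And>j. j < ?n \<Longrightarrow> f j < ?m" "\<And>j. j < ?n \<Longrightarrow> \<phi> (a j) = b (f j)"
    by metis
  have "f i < f j" if "i < j" "j < ?n" for i j
  proof -
    have "[a i, a j] \<in> interp A lt" using a that by (auto simp: enumerates_def)
    then have "map \<phi> [a i, a j] \<in> interp B lt"
      using \<phi> a' that \<open>ar lt = 2\<close> unfolding embeddings_def by fastforce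
    then show ?thesis using b f that by (auto simp: enumerates_def)
  qed
  then have "strict_mono_on {..<?n} f" by (auto simp: strict_mono_on_def)
  then show thesis using that f by blast
qed

section \<open>From colourings of embeddings to colourings of transversals\<close>

theorem theorem4p3:
  fixes \<Theta> :: "'r set" and ar :: "'r \<Rightarrow> nat" and lt :: 'r
  assumes "\<forall>R\<in>\<Theta>. ar R > 0"
    and "lt \<notin> \<Theta>" and "ar lt = 2"
    and "infinite (UNIV :: 'u set)"
  shows "ramsey_property (Rel \<Theta> ar lt :: (('r, 'u) rel_structure, 'u \<Rightarrow> 'u) category)"
  unfolding ramsey_property_def
proof (intro allI impI ballI)
  let ?Rel = "Rel \<Theta> ar lt :: (('r, 'u) rel_structure, 'u \<Rightarrow> 'u) category"
  fix k :: nat and A B :: "('r, 'u) rel_structure"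
  assume "A \<in> Obj ?Rel" "B \<in> Obj ?Rel"
  then obtain a b where a: "enumerates lt a A" and b: "enumerates lt b B"
    unfolding Rel_def using ex_enumerates by fastforce
  assume "k \<ge> 2"
  let ?n = "card (univ A)" and ?m = "card (univ B)"
  have bija: "bij_betw a {..<?n} (univ A)" and bijb: "bij_betw b {..<?m} (univ B)"
    using a b by (auto simp: enumerates_def)
  obtain \<iota> :: "nat \<times> nat \<Rightarrow> 'u" where \<iota>: "inj \<iota>"
    using infinite_countable_subset[OF assms(4)] inj_compose[OF _ inj_prod_encode] by blast
  obtain p V and t :: "(nat \<rightharpoonup> nat) \<Rightarrow> ('r \<times> nat list) set" where "finite V"
    and t: "\<And>\<chi>. \<forall>s. \<chi> s < k \<Longrightarrow> \<exists>d g c. strict_mono_on {..<?m} d \<and> d ` {..<?m} \<subseteq> {..<p::nat} \<and>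
       g ` d ` {..<?m} \<subseteq> V \<and> (\<forall>E\<subseteq>{..<?m}. t ((Some \<circ> g) |` (d ` E)) = induced_type \<Theta> ar b B E) \<and>
       (\<forall>f. strict_mono_on {..<?n} f \<longrightarrow> f ` {..<?n} \<subseteq> {..<?m} \<longrightarrow>
          (\<forall>E\<subseteq>{..<?n}. induced_type \<Theta> ar b B (f ` E) = induced_type \<Theta> ar a A E) \<longrightarrow>
          \<chi> ((Some \<circ> g) |` (d ` f ` {..<?n})) = c)"
    using ordered_type_Ramsey[of k ?m "induced_type \<Theta> ar b B" ?n "induced_type \<Theta> ar a A"] by metis
  define C where "C = partite_structure \<Theta> ar lt \<iota> ({..<p} \<times> V) t"
  have "finite (univ C)" using \<open>finite V\<close> by (simp add: C_def partite_structure_def)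
  then have C: "C \<in> Obj ?Rel"
    using linearly_ordered_partite_structure[of \<iota> ar lt, OF \<iota> assms(3)] by (simp add: Rel_def C_def)
  have "arrows ?Rel C B A k"
    unfolding arrows_def
  proof (intro allI impI)
    fix \<chi> assume \<chi>: "\<chi> \<in> Hom ?Rel A C \<rightarrow> {1..k}"
    \<comment> \<open>The element of \<open>A\<close> at position \<open>j\<close> goes to the
      vertex of \<open>s\<close> at the index of rank \<open>j\<close> in \<open>dom s\<close>; this
      turns a transversal into a candidate embedding.\<close>
    define h where "h s = (\<lambda>x\<in>univ A.
      let i = inv_into (dom s) (rank (dom s)) (inv_into {..<?n} a x) in \<iota> (i, the (s i)))"
      for s :: "nat \<rightharpoonup> nat"
    \<comment> \<open>Colours are shifted from \<open>{1..k}\<close> to \<open>{..<k}\<close>. The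
      default 0 serves those \<open>s\<close> for which \<open>h s\<close> is no embedding and
      \<open>\<chi>\<close> may leave \<open>{1..k}\<close>.\<close>
    define \<chi>' where "\<chi>' s = (if \<chi> (h s) \<in> {1..k} then \<chi> (h s) - 1 else 0)" for s
    have "\<forall>s. \<chi>' s < k" using \<open>k \<ge> 2\<close> by (auto simp: \<chi>'_def)
    from t[OF this] obtain d g c where d: "strict_mono_on {..<?m} d" "d ` {..<?m} \<subseteq> {..<p}"
      and g: "g ` d ` {..<?m} \<subseteq> V"
      and types: "\<forall>E\<subseteq>{..<?m}. t ((Some \<circ> g) |` (d ` E)) = induced_type \<Theta> ar b B E"
      and c: "\<forall>f. strict_mono_on {..<?n} f \<longrightarrow> f ` {..<?n} \<subseteq> {..<?m} \<longrightarrow>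
          (\<forall>E\<subseteq>{..<?n}. induced_type \<Theta> ar b B (f ` E) = induced_type \<Theta> ar a A E) \<longrightarrow>
          \<chi>' ((Some \<circ> g) |` (d ` f ` {..<?n})) = c"
      by (elim exE conjE)
    \<comment> \<open>The copy of \<open>B\<close> given by \<open>d\<close> and \<open>g\<close>,
      as a map on \<open>univ B\<close>.\<close>
    define w where "w = (\<lambda>x\<in>univ B. let i = d (inv_into {..<?m} b x) in \<iota> (i, g i))"
    have wb: "w (b j) = \<iota> (d j, g (d j))" if "j < ?m" for j
      using that bij_betwE[OF bijb] bij_betw_inv_into_left[OF bijb, of j]
      by (simp add: w_def Let_def)
    have ext: "w \<in> extensional (univ B)" by (simp add: w_def)
    have P: "(\<lambda>i. (i, g i)) ` d ` {..<?m} \<subseteq> {..<p} \<times> V" using d(2) g by auto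
    have w: "w \<in> embeddings (insert lt \<Theta>) ar B C"
      unfolding C_def by (rule partite_structure_embedding[OF \<iota> assms(3,2) b d(1) P types[rule_format] ext wb])
    have "\<chi> (compose (univ A) w \<phi>) = Suc c" if \<phi>: "\<phi> \<in> embeddings (insert lt \<Theta>) ar A B" for \<phi>
    proof -
      obtain f where f: "strict_mono_on {..<?n} f" "f ` {..<?n} \<subseteq> {..<?m}"
        "\<And>j. j < ?n \<Longrightarrow> \<phi> (a j) = b (f j)"
        using embedding_indices[OF \<phi> assms(3) a b] by blast
      define s where "s = (Some \<circ> g) |` (d ` f ` {..<?n})"
      have df: "strict_mono_on {..<?n} (d \<circ> f)"
        using f(1,2) d(1) by (auto simp: strict_mono_on_def image_subset_iff)
      have dom: "dom s = (d \<circ> f) ` {..<?n}" unfolding s_def dom_Some_restrict by (simp add: image_comp)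
      \<comment> \<open>Ranks in \<open>dom s\<close> undo \<open>d \<circ> f\<close>, so
        \<open>h\<close> recovers the composite from its transversal.\<close>
      have "h s x = compose (univ A) w \<phi> x" for x
      proof (cases "x \<in> univ A")
        case True
        then obtain j where j: "j < ?n" "x = a j" using bija by (auto simp: bij_betw_def)
        have "inv_into {..<?n} a x = j" using bij_betw_inv_into_left[OF bija] j by simp
        moreover have "inv_into (dom s) (rank (dom s)) j = d (f j)"
          using rank_image[OF df j(1)] j(1) inj_on_rank[of "dom s"]
          by (intro inv_into_f_eq) (auto simp: dom)
        moreover have "s (d (f j)) = Some (g (d (f j)))" using j(1) by (simp add: s_def)
        ultimately have "h s x = \<iota> (d (f j), g (d (f j)))" using True by (simp add: h_def Let_def)
        also have "\<dots> = w (\<phi> x)" using j f(2,3) wb by auto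
        finally show ?thesis using True by (simp add: compose_eq)
      next
        case False
        then show ?thesis by (simp add: h_def compose_def)
      qed
      then have hs: "h s = compose (univ A) w \<phi>" by blast
      have "\<forall>E\<subseteq>{..<?n}. induced_type \<Theta> ar b B (f ` E) = induced_type \<Theta> ar a A E"
        using induced_type_embedding[OF \<phi> subset_insertI _ f(1), of a b] bij_betwE[OF bija] f(3)
        by auto
      then have "\<chi>' s = c" unfolding s_def using c f(1,2) by blast
      moreover have "compose (univ A) w \<phi> \<in> Hom ?Rel A C"
        using embeddings_compose[OF \<phi> w] by (simp add: Rel_def)
      then have "\<chi> (h s) \<in> {1..k}" unfolding hs using \<chi> by blast
      ultimately show ?thesis unfolding \<chi>'_def hs by auto
    qed
    then show "\<exists>w\<in>Hom ?Rel B C. \<exists>c. \<forall>f\<in>Hom ?Rel A B. \<chi> (Comp ?Rel A B C w f) = c"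
      using w by (auto simp: Rel_def)
  qed
  then show "\<exists>C\<in>Obj ?Rel. arrows ?Rel C B A k" using C by blast
qed

end
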